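(* Let $p_1,\dots,p_N$ and $t_1,\dots,t_N>0$ be real numbers with $\frac{p_1}{t_1}\ge\dots\ge\frac{p_N}{t_N}$, and let $k,n\ge1$ be integers with $k+n\le N$. Suppose that for each $i=1,\dots,N$ we have $c\le p_i\le d$ for some $c,d\in(0,1)$ and $t_i=T$ for some $T>0$ (with $c,d,T$ independent of $i$). Then $$EXC\le T\,d\,\frac{p_k-p_{k+n}}{1-p_k}\,\frac{(1-c)^k}{c^2}\left(A-B(1-c)^{n-1}\right),$$ where $$A=1+kc\left[1-\frac{1-p_k}{1-c}\,\frac cd\left(\frac{1-d}{1-c}\right)^{k-1}\right],\qquad B=1-c+c(n+k)\left(1-\frac cd\right).$$
   Context: Here $p_i$ is the success probability and $t_i$ the execution time of the $i$-th solution candidate. $T_m=\sum_{i=1}^m t_i$, $Q_m=\prod_{i=1}^m(1-p_i)$ (empty sums are $0$, empty products are $1$). The quantity $EXC$ (the excess expected time caused by exchanging the $k$-th and $(k+n)$-th candidates in the optimal order) is defined by $EXC=q_1+q_2+q_3$ with $$q_1=T_{k-1}Q_{k-1}(p_{k+n}-p_k)+Q_{k-1}(t_{k+n}p_{k+n}-t_kp_k),$$ $$q_2=\sum_{l=k+1}^{k+n-1}Q_{l-1}\,p_l\left(T_l\,\frac{p_k-p_{k+n}}{1-p_k}+(t_{k+n}-t_k)\frac{1-p_{k+n}}{1-p_k}\right),$$ $$q_3=T_{k+n}\,Q_{k+n-1}\,\frac{p_k-p_{k+n}}{1-p_k}.$$ *)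

theory Defs
  imports Complex_Main
begin

text \<open>
  Candidates are indexed from 1: \<open>p i\<close> is the success probability and \<open>t i\<close> the execution
  time of the \<open>i\<close>-th candidate.  The values \<open>p 0\<close> and \<open>t 0\<close> are never used.
\<close>

definition total_time :: "(nat \<Rightarrow> real) \<Rightarrow> nat \<Rightarrow> real" where
  "total_time t m = (\<Sum>i=1..m. t i)"

definition fail_prob :: "(nat \<Rightarrow> real) \<Rightarrow> nat \<Rightarrow> real" where
  "fail_prob p m = (\<Prod>i=1..m. 1 - p i)"

text \<open>
  The excess expected time caused by exchanging the candidates \<open>k\<close> and \<open>k + n\<close> is the sum of
  the following three terms.  They are meant for \<open>k \<ge> 1\<close> and \<open>n \<ge> 1\<close>, so that the subtractions
  on natural numbers do not truncate.  For \<open>n = 1\<close> the sum in \<open>exc_q2\<close> is empty.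
\<close>

definition exc_q1 :: "(nat \<Rightarrow> real) \<Rightarrow> (nat \<Rightarrow> real) \<Rightarrow> nat \<Rightarrow> nat \<Rightarrow> real" where
  "exc_q1 p t k n =
     total_time t (k - 1) * fail_prob p (k - 1) * (p (k + n) - p k)
     + fail_prob p (k - 1) * (t (k + n) * p (k + n) - t k * p k)"

definition exc_q2 :: "(nat \<Rightarrow> real) \<Rightarrow> (nat \<Rightarrow> real) \<Rightarrow> nat \<Rightarrow> nat \<Rightarrow> real" where
  "exc_q2 p t k n =
     (\<Sum>l = k + 1..k + n - 1. fail_prob p (l - 1) * p l *
        (total_time t l * ((p k - p (k + n)) / (1 - p k))
         + (t (k + n) - t k) * ((1 - p (k + n)) / (1 - p k))))"

definition exc_q3 :: "(nat \<Rightarrow> real) \<Rightarrow> (nat \<Rightarrow> real) \<Rightarrow> nat \<Rightarrow> nat \<Rightarrow> real" where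
  "exc_q3 p t k n =
     total_time t (k + n) * fail_prob p (k + n - 1) * ((p k - p (k + n)) / (1 - p k))"

definition EXC :: "(nat \<Rightarrow> real) \<Rightarrow> (nat \<Rightarrow> real) \<Rightarrow> nat \<Rightarrow> nat \<Rightarrow> real" where
  "EXC p t k n = exc_q1 p t k n + exc_q2 p t k n + exc_q3 p t k n"

end

theory Submission
  imports Defs
begin

text \<open>
  When every candidate takes the same time \<open>T\<close>, all three parts of the excess contain the factor
  \<open>T (p\<^sub>k - p\<^sub>k\<^sub>+\<^sub>n) / (1 - p\<^sub>k)\<close>, and what remains is
  \<open>(\<Sum>l=k+1..k+n-1. l Q\<^sub>l\<^sub>-\<^sub>1 p\<^sub>l) + (k + n) Q\<^sub>k\<^sub>+\<^sub>n\<^sub>-\<^sub>1 - k (1 - p\<^sub>k) Q\<^sub>k\<^sub>-\<^sub>1\<close>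
  (\<open>EXC_const_time\<close>).  The common factor is nonnegative, because for equal times the ordering by
  \<open>p\<^sub>i / t\<^sub>i\<close> makes the \<open>p\<^sub>i\<close> decrease; so it suffices to bound the remaining bracket.

  There the bounds \<open>(1 - d)\<^sup>m \<le> Q\<^sub>m \<le> (1 - c)\<^sup>m\<close> (\<open>fail_prob_bounds\<close>) are used termwise: the upper
  one, together with \<open>p\<^sub>l \<le> d\<close>, in the two positive parts and the lower one in the negative part.
  The sum becomes \<open>d (\<Sum>l=k+1..k+n-1. l (1 - c)\<^sup>l\<^sup>-\<^sup>1)\<close>, an arithmetic-geometric sum with a closed
  form (\<open>arith_geometric_sum\<close>).  Taking the factor \<open>d (1 - c)\<^sup>k / c\<^sup>2\<close> out of the result leaves
  exactly \<open>A - B (1 - c)\<^sup>n\<^sup>-\<^sup>1\<close>: the negative part enters \<open>A\<close> and the term with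
  \<open>(k + n) (1 - c)\<^sup>k\<^sup>+\<^sup>n\<^sup>-\<^sup>1\<close> enters \<open>B\<close>.
\<close>

lemma total_time_const:
  assumes "\<And>i. i \<in> {1..m} \<Longrightarrow> t i = T"
  shows "total_time t m = real m * T"
  using assms by (simp add: total_time_def)

lemma fail_prob_bounds:
  assumes "d \<le> 1" and "\<And>i. i \<in> {1..m} \<Longrightarrow> c \<le> p i \<and> p i \<le> d"
  shows "(1 - d) ^ m \<le> fail_prob p m" and "fail_prob p m \<le> (1 - c) ^ m"
proof -
  have "(\<Prod>i=1..m. 1 - d) \<le> (\<Prod>i=1..m. 1 - p i)"
    using assms by (intro prod_mono) auto
  then show "(1 - d) ^ m \<le> fail_prob p m"
    by (simp add: fail_prob_def)
  have "(\<Prod>i=1..m. 1 - p i) \<le> (\<Prod>i=1..m. 1 - c)"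
    using assms by (intro prod_mono) force
  then show "fail_prob p m \<le> (1 - c) ^ m"
    by (simp add: fail_prob_def)
qed

text \<open>
  For real \<open>c\<close> with \<open>0 < c < 1\<close> the right-hand side is the difference of the tails of
  \<open>\<Sum>l. l (1 - c)\<^sup>l\<^sup>-\<^sup>1\<close> from \<open>k + 1\<close> and from \<open>k + n\<close> on, multiplied by \<open>c\<^sup>2\<close>.  That factor keeps
  the identity free of division, so that it holds in every commutative ring.
\<close>

lemma arith_geometric_sum:
  fixes c :: "'a :: comm_ring_1"
  assumes "n \<ge> 1"
  shows "c\<^sup>2 * (\<Sum>l = k + 1..k + n - 1. of_nat l * (1 - c) ^ (l - 1)) =
    (1 - c) ^ k * (1 + of_nat k * c - (1 - c) ^ (n - 1) * (1 - c + c * of_nat (n + k)))"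
  using assms
proof (induction n rule: nat_induct_at_least)
  case base
  then show ?case by (simp add: algebra_simps)
next
  case (Suc n)
  have "{k + 1..k + Suc n - 1} = insert (k + n) {k + 1..k + n - 1}"
    using Suc.hyps by auto
  moreover have "k + n \<notin> {k + 1..k + n - 1}"
    using Suc.hyps by auto
  ultimately have "c\<^sup>2 * (\<Sum>l = k + 1..k + Suc n - 1. of_nat l * (1 - c) ^ (l - 1)) =
      c\<^sup>2 * (\<Sum>l = k + 1..k + n - 1. of_nat l * (1 - c) ^ (l - 1))
      + c\<^sup>2 * (of_nat (k + n) * (1 - c) ^ (k + n - 1))"
    by (simp add: algebra_simps)
  also have "\<dots> = (1 - c) ^ k * (1 + of_nat k * c
      - (1 - c) ^ (Suc n - 1) * (1 - c + c * of_nat (Suc n + k)))"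
  proof -
    obtain m where m: "n = Suc m"
      using Suc.hyps by (cases n) auto
    show ?thesis
      unfolding Suc.IH unfolding m
      by (simp add: power_add power2_eq_square algebra_simps)
  qed
  finally show ?case .
qed

text \<open>
  For equal times the part of \<open>exc_q2\<close> with \<open>t (k + n) - t k\<close> vanishes, and the two summands of
  \<open>exc_q1\<close> combine, since \<open>(k - 1) T + T = k T\<close>.  The term \<open>exc_q1\<close> has no denominator \<open>1 - p\<^sub>k\<close>; the
  factor \<open>1 - p k\<close> next to \<open>fail_prob p (k - 1)\<close> compensates for it.
\<close>

lemma EXC_const_time:
  assumes "k \<ge> 1" and "n \<ge> 1" and "p k \<noteq> 1"
    and t_const: "\<And>i. i \<in> {1..k + n} \<Longrightarrow> t i = T"
  shows "EXC p t k n = T * ((p k - p (k + n)) / (1 - p k)) *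
    ((\<Sum>l = k + 1..k + n - 1. real l * (fail_prob p (l - 1) * p l))
     + real (k + n) * fail_prob p (k + n - 1)
     - real k * ((1 - p k) * fail_prob p (k - 1)))"
proof -
  define r where "r = (p k - p (k + n)) / (1 - p k)"
  have time: "total_time t m = real m * T" if "m \<le> k + n" for m
    using that t_const by (intro total_time_const) auto
  have tk: "t k = T" "t (k + n) = T"
    using assms by auto
  have diff: "p k - p (k + n) = r * (1 - p k)"
    using \<open>p k \<noteq> 1\<close> by (simp add: r_def)
  have pre: "total_time t (k - 1) = real k * T - T"
    using \<open>k \<ge> 1\<close> time[of "k - 1"] by (simp add: of_nat_diff algebra_simps)
  have "exc_q1 p t k n = - (T * real k * fail_prob p (k - 1) * (p k - p (k + n)))"
    unfolding exc_q1_def tk pre by (simp add: algebra_simps)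
  then have q1: "exc_q1 p t k n = - (T * r * (real k * ((1 - p k) * fail_prob p (k - 1))))"
    by (simp add: diff)
  have "exc_q2 p t k n =
      (\<Sum>l = k + 1..k + n - 1. T * r * (real l * (fail_prob p (l - 1) * p l)))"
    unfolding exc_q2_def
    by (rule sum.cong) (auto simp: tk time r_def)
  then have q2: "exc_q2 p t k n =
      T * r * (\<Sum>l = k + 1..k + n - 1. real l * (fail_prob p (l - 1) * p l))"
    by (simp add: sum_distrib_left)
  have q3: "exc_q3 p t k n = T * r * (real (k + n) * fail_prob p (k + n - 1))"
    by (simp add: exc_q3_def time r_def)
  show ?thesis
    unfolding EXC_def q1 q2 q3 r_def[symmetric] by (simp add: algebra_simps)
qed

theorem theorem4p4:
  fixes p t :: "nat \<Rightarrow> real" and N k n :: nat and c d T A B :: real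
  assumes t_pos: "\<And>i. i \<in> {1..N} \<Longrightarrow> t i > 0"
    and ordered: "\<And>i. i \<in> {1..<N} \<Longrightarrow> p i / t i \<ge> p (i + 1) / t (i + 1)"
    and "k \<ge> 1" and "n \<ge> 1" and "k + n \<le> N"
    and "c \<in> {0<..<1}" and "d \<in> {0<..<1}" and "T > 0"
    and p_bounds: "\<And>i. i \<in> {1..N} \<Longrightarrow> c \<le> p i \<and> p i \<le> d"
    and t_const: "\<And>i. i \<in> {1..N} \<Longrightarrow> t i = T"
    and A_def: "A = 1 + real k * c *
                  (1 - (1 - p k) / (1 - c) * (c / d) * ((1 - d) / (1 - c)) ^ (k - 1))"
    and B_def: "B = 1 - c + c * real (n + k) * (1 - c / d)"
  shows "EXC p t k n \<le>
           T * d * ((p k - p (k + n)) / (1 - p k)) * ((1 - c) ^ k / c\<^sup>2) *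
           (A - B * (1 - c) ^ (n - 1))"
proof -
  define Q where "Q = fail_prob p"
  define x where "x = 1 - c"
  have c: "0 < c" and x: "0 < x" and d: "0 < d" "d < 1"
    using assms by (auto simp: x_def)
  have pk: "p k < 1"
    using p_bounds[of k] d \<open>k \<ge> 1\<close> \<open>k + n \<le> N\<close> by force
  have Q_bounds: "(1 - d) ^ m \<le> Q m" "Q m \<le> x ^ m" if "m \<le> N" for m
    unfolding Q_def x_def using that d p_bounds by (auto intro!: fail_prob_bounds[of d m c p])

  have step: "p (i + 1) \<le> p i" if "i \<in> {1..<N}" for i
    using ordered[OF that] t_const[of i] t_const[of "i + 1"] that \<open>T > 0\<close>
    by (simp add: divide_le_cancel)
  have "p (k + j) \<le> p k" if "k + j \<le> N" for j
    using that
  proof (induction j)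
    case (Suc j)
    then show ?case
      using step[of "k + j"] \<open>k \<ge> 1\<close> by auto
  qed simp
  then have D: "p (k + n) \<le> p k"
    using \<open>k + n \<le> N\<close> .

  have pos_sum: "(\<Sum>l = k + 1..k + n - 1. real l * (Q (l - 1) * p l)) \<le>
      d * (\<Sum>l = k + 1..k + n - 1. real l * x ^ (l - 1))"
  proof -
    have "real l * (Q (l - 1) * p l) \<le> d * (real l * x ^ (l - 1))"
      if "l \<in> {k + 1..k + n - 1}" for l
    proof -
      have l: "l \<in> {1..N}"
        using that \<open>k + n \<le> N\<close> by auto
      have "Q (l - 1) * p l \<le> x ^ (l - 1) * d"
        using l x c p_bounds[OF l] Q_bounds(2)[of "l - 1"] by (intro mult_mono) auto
      then show ?thesis
        by (metis (no_types, lifting) mult.left_commute mult.commute mult_left_mono of_nat_0_le_iff)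
    qed
    then show ?thesis
      unfolding sum_distrib_left by (rule sum_mono)
  qed
  have pos_last: "real (k + n) * Q (k + n - 1) \<le> real (k + n) * x ^ (k + n - 1)"
    using Q_bounds(2)[of "k + n - 1"] \<open>k + n \<le> N\<close> by (intro mult_left_mono) auto
  have neg: "real k * ((1 - p k) * (1 - d) ^ (k - 1)) \<le> real k * ((1 - p k) * Q (k - 1))"
    using Q_bounds(1)[of "k - 1"] \<open>k + n \<le> N\<close> pk by (intro mult_left_mono) auto

  define S where "S = (\<Sum>l = k + 1..k + n - 1. real l * x ^ (l - 1))"
  have S: "c\<^sup>2 * S = x ^ k * (1 + real k * c - x ^ (n - 1) * (x + c * real (n + k)))"
    unfolding S_def x_def using arith_geometric_sum[OF \<open>n \<ge> 1\<close>, of c k] by simp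

  have closed: "d * S + real (k + n) * x ^ (k + n - 1) - real k * ((1 - p k) * (1 - d) ^ (k - 1))
      = d * (x ^ k / c\<^sup>2) * (A - B * x ^ (n - 1))"
  proof -
    \<comment> \<open>Multiplied by \<open>c\<^sup>2\<close>, both sides are polynomials: the factor \<open>x\<^sup>k\<close> absorbs the denominators
      of \<open>A\<close>, and \<open>d\<close> those of \<open>c / d\<close>.\<close>
    have xk: "x ^ k = x * x ^ (k - 1)"
      using \<open>k \<ge> 1\<close> by (simp flip: power_Suc)
    have A': "d * x ^ k * A =
        d * x ^ k * (1 + real k * c) - c\<^sup>2 * (real k * ((1 - p k) * (1 - d) ^ (k - 1)))"
      unfolding A_def x_def[symmetric] xk using x d
      by (simp add: power_divide field_simps power2_eq_square)
    have B': "d * B = d * (x + c * real (n + k)) - c\<^sup>2 * real (k + n)"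
      unfolding B_def x_def using d by (simp add: field_simps power2_eq_square)
    have xkn: "x ^ (k + n - 1) = x ^ k * x ^ (n - 1)"
      using \<open>n \<ge> 1\<close> by (simp flip: power_add)
    have "d * x ^ k * (A - B * x ^ (n - 1)) = d * x ^ k * A - x ^ k * x ^ (n - 1) * (d * B)"
      by (simp add: algebra_simps)
    also have "\<dots> = d * (c\<^sup>2 * S)
        + c\<^sup>2 * (real (k + n) * x ^ (k + n - 1) - real k * ((1 - p k) * (1 - d) ^ (k - 1)))"
      unfolding A' B' S xkn by (simp add: algebra_simps)
    also have "\<dots> = c\<^sup>2 * (d * S + real (k + n) * x ^ (k + n - 1)
        - real k * ((1 - p k) * (1 - d) ^ (k - 1)))"
      by (simp add: algebra_simps)
    finally show ?thesis
      using c by (simp add: field_simps)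
  qed

  have "EXC p t k n = T * ((p k - p (k + n)) / (1 - p k)) *
      ((\<Sum>l = k + 1..k + n - 1. real l * (Q (l - 1) * p l))
       + real (k + n) * Q (k + n - 1) - real k * ((1 - p k) * Q (k - 1)))"
    unfolding Q_def using assms pk by (intro EXC_const_time) auto
  also have "\<dots> \<le> T * ((p k - p (k + n)) / (1 - p k)) *
      (d * S + real (k + n) * x ^ (k + n - 1) - real k * ((1 - p k) * (1 - d) ^ (k - 1)))"
  proof (rule mult_left_mono)
    show "(\<Sum>l = k + 1..k + n - 1. real l * (Q (l - 1) * p l))
        + real (k + n) * Q (k + n - 1) - real k * ((1 - p k) * Q (k - 1))
      \<le> d * S + real (k + n) * x ^ (k + n - 1) - real k * ((1 - p k) * (1 - d) ^ (k - 1))"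
      using pos_sum pos_last neg unfolding S_def by linarith
    show "0 \<le> T * ((p k - p (k + n)) / (1 - p k))"
      using \<open>T > 0\<close> D pk by simp
  qed
  also have "\<dots> = T * d * ((p k - p (k + n)) / (1 - p k)) * ((1 - c) ^ k / c\<^sup>2) *
      (A - B * (1 - c) ^ (n - 1))"
    unfolding closed by (simp add: x_def)
  finally show ?thesis .
qed

end
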